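(* Let $\mathcal P=(Q,T)$ be a parameterized system with initial local state $q_0\in Q$, $Init=q_0^*$, let $F\subseteq Q^*$ be finite and $B=\{\bar c\mid\exists\bar w\in F,\ \bar w\preceq\bar c\}$. Let $U$ be the set at which the symbolic backward reachability iteration $U_0=B$, $U_{i+1}=U_i\cup Pre(U_i)$ stabilizes (i.e. $U=U_n$ with $U_{n+1}=U_n$). If $Init\cap U=\emptyset$, then there exists a finite model of $\Phi_{\mathcal P}\wedge\neg\Psi_F$.
   Context: A parameterized system is a pair $\mathcal P=(Q,T)$ of a finite set $Q$ of local states and a finite set $T$ of rules of the form $q\to q'$ or $\mathcal G: q\to q'$ ($q,q'\in Q$), with $\mathcal G$ a condition $\forall_I J$ or $\exists_I J$, $J\subseteq Q$, $I\in\{L,R,LR\}$. Configurations are words $\bar c=c_1\cdots c_n\in Q^*$. For a position $i$: $(\bar c,i)\models\forall_L J$ iff $c_k\in J$ for all $k<i$; $\forall_R J$ iff for all $k>i$; $\forall_{LR}J$ iff both; $\exists_L J$ iff $c_k\in J$ for some $k<i$; $\exists_R J$ iff for some $k>i$; $\exists_{LR}J$ iff $\exists_L J$ or $\exists_R J$. $\bar c\to_{\mathcal P}\bar c'$ iff for some position $i$ and either a rule $q\to q'$ in $T$, or a rule $\mathcal G:q\to q'$ with $(\bar c,i)\models\mathcal G$, we have $c_i=q$, $c'_i=q'$ and $c'_j=c_j$ for $j\ne i$. $\bar w\preceq\bar w'$ means $\bar w$ is a (not necessarily contiguous) subword of $\bar w'$; this is a well quasi-ordering, so the iteration stabilizes.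 Monotone abstraction: $\bar c_1\to^A_{\mathcal P}\bar c_2$ iff there is $\bar c_1'\preceq\bar c_1$ with $\bar c_1'\to_{\mathcal P}\bar c_2$. $Pre(U)=\{\bar c\mid\exists\bar c'\in U,\ \bar c\to^A_{\mathcal P}\bar c'\}$. Encoding: vocabulary has a constant for each $q\in Q$, an extra constant $e\notin Q$, binary function $*$, unary relations $In$, $R$, and a unary $P^J$ for each condition $\forall_I J$ in $T$. $\Phi_{\mathcal P}$ is the set of universal closures of: $(x*y)*z=x*(y*z)$, $e*x=x$, $x*e=x$; $In(e)$, $In(x)\to In(x*q_0)$, $In(x)\to R(x)$; for each such $J$: $P^J(e)$ and $P^J(x)\to P^J(x*q)$ for all $q\in J$; for each rule $q_1\to q_2$: $R((x*q_1)*y)\to R((x*q_2)*y)$; for $\forall_L J:q_1\to q_2$: $R((x*q_1)*y)\wedge P^J(x)\to R((x*q_2)*y)$; for $\forall_R J$: same with $P^J(y)$; for $\forall_{LR}J$: with $P^J(x)\wedge P^J(y)$; for $\exists_L J:q_1\to q_2$ and each $q\in J$: $R((x*q_1)*y)\wedge x=(z*q)*w\to R((x*q_2)*y)$; for $\exists_R J$: same with $y=(z*q)*w$; for $\exists_{LR}J$: same with $x=(z*q)*w\vee y=(z*q)*w$. For $\bar w=w_1\cdots w_n$, $\psi_{\bar w}$ is $R(x_0*w_1*x_1*\cdots*w_n*x_n)$ with distinct variables, and $\Psi_F=\exists\bar x\bigvee_{\bar w\in F}\psi_{\bar w}$ (all variables existentially quantified). *)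

theory Defs
  imports Main "HOL-Library.Sublist"
begin

section \<open>Parameterized systems\<close>

datatype scope = L | R | LR

datatype 'q guard = AllG scope "'q set" | ExG scope "'q set"

datatype 'q rule = Free 'q 'q | Guarded "'q guard" 'q 'q

fun guard_set :: "'q guard \<Rightarrow> 'q set" where
  "guard_set (AllG I J) = J"
| "guard_set (ExG I J) = J"

fun rule_over :: "'q set \<Rightarrow> 'q rule \<Rightarrow> bool" where
  "rule_over Q (Free q q') \<longleftrightarrow> q \<in> Q \<and> q' \<in> Q"
| "rule_over Q (Guarded G q q') \<longleftrightarrow> guard_set G \<subseteq> Q \<and> q \<in> Q \<and> q' \<in> Q"

definition param_system :: "'q set \<Rightarrow> 'q rule set \<Rightarrow> bool" where
  "param_system Q T \<longleftrightarrow> finite Q \<and> finite T \<and> (\<forall>r\<in>T. rule_over Q r)"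

text \<open>Configurations are the elements of \<^term>\<open>lists Q\<close>; positions are counted from \<open>0\<close>.\<close>

fun guard_holds :: "'q list \<Rightarrow> nat \<Rightarrow> 'q guard \<Rightarrow> bool" where
  "guard_holds c i (AllG L J) \<longleftrightarrow> (\<forall>k<i. c ! k \<in> J)"
| "guard_holds c i (AllG R J) \<longleftrightarrow> (\<forall>k. i < k \<and> k < length c \<longrightarrow> c ! k \<in> J)"
| "guard_holds c i (AllG LR J) \<longleftrightarrow>
     (\<forall>k<i. c ! k \<in> J) \<and> (\<forall>k. i < k \<and> k < length c \<longrightarrow> c ! k \<in> J)"
| "guard_holds c i (ExG L J) \<longleftrightarrow> (\<exists>k<i. c ! k \<in> J)"
| "guard_holds c i (ExG R J) \<longleftrightarrow> (\<exists>k. i < k \<and> k < length c \<and> c ! k \<in> J)"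
| "guard_holds c i (ExG LR J) \<longleftrightarrow>
     (\<exists>k<i. c ! k \<in> J) \<or> (\<exists>k. i < k \<and> k < length c \<and> c ! k \<in> J)"

definition step :: "'q rule set \<Rightarrow> 'q list \<Rightarrow> 'q list \<Rightarrow> bool" where
  "step T c c' \<longleftrightarrow> length c' = length c \<and>
     (\<exists>i<length c. \<exists>q q'.
        (Free q q' \<in> T \<or> (\<exists>G. Guarded G q q' \<in> T \<and> guard_holds c i G)) \<and>
        c ! i = q \<and> c' ! i = q' \<and> (\<forall>j<length c. j \<noteq> i \<longrightarrow> c' ! j = c ! j))"

definition abs_step :: "'q rule set \<Rightarrow> 'q list \<Rightarrow> 'q list \<Rightarrow> bool" where
  "abs_step T c1 c2 \<longleftrightarrow> (\<exists>c1'. subseq c1' c1 \<and> step T c1' c2)"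

definition Pre :: "'q set \<Rightarrow> 'q rule set \<Rightarrow> 'q list set \<Rightarrow> 'q list set" where
  "Pre Q T U = {c \<in> lists Q. \<exists>c'\<in>U. abs_step T c c'}"

definition bad_configs :: "'q set \<Rightarrow> 'q list set \<Rightarrow> 'q list set" where
  "bad_configs Q F = {c \<in> lists Q. \<exists>w\<in>F. subseq w c}"

definition init_configs :: "'q \<Rightarrow> 'q list set" where
  "init_configs q0 = {replicate n q0 | n. True}"

primrec backward_iter :: "'q set \<Rightarrow> 'q rule set \<Rightarrow> 'q list set \<Rightarrow> nat \<Rightarrow> 'q list set" where
  "backward_iter Q T B 0 = B"
| "backward_iter Q T B (Suc i) = backward_iter Q T B i \<union> Pre Q T (backward_iter Q T B i)"


section \<open>First-order logic with equality\<close>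

datatype 'f tm = Var nat | Fn 'f "'f tm list"

datatype ('f, 'r) fm =
    Bot
  | Rel 'r "'f tm list"
  | Eq "'f tm" "'f tm"
  | Neg "('f, 'r) fm"
  | And "('f, 'r) fm" "('f, 'r) fm"
  | Or "('f, 'r) fm" "('f, 'r) fm"
  | Imp "('f, 'r) fm" "('f, 'r) fm"
  | Forall nat "('f, 'r) fm"
  | Exists nat "('f, 'r) fm"

primrec tvars :: "'f tm \<Rightarrow> nat set" where
  "tvars (Var x) = {x}"
| "tvars (Fn f ts) = \<Union> (set (map tvars ts))"

primrec fvars :: "('f, 'r) fm \<Rightarrow> nat set" where
  "fvars Bot = {}"
| "fvars (Rel r ts) = \<Union> (tvars ` set ts)"
| "fvars (Eq s t) = tvars s \<union> tvars t"
| "fvars (Neg \<phi>) = fvars \<phi>"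
| "fvars (And \<phi> \<psi>) = fvars \<phi> \<union> fvars \<psi>"
| "fvars (Or \<phi> \<psi>) = fvars \<phi> \<union> fvars \<psi>"
| "fvars (Imp \<phi> \<psi>) = fvars \<phi> \<union> fvars \<psi>"
| "fvars (Forall x \<phi>) = fvars \<phi> - {x}"
| "fvars (Exists x \<phi>) = fvars \<phi> - {x}"

definition all_closure :: "('f, 'r) fm \<Rightarrow> ('f, 'r) fm" where
  "all_closure \<phi> = foldr Forall (sorted_list_of_set (fvars \<phi>)) \<phi>"

definition ex_closure :: "('f, 'r) fm \<Rightarrow> ('f, 'r) fm" where
  "ex_closure \<phi> = foldr Exists (sorted_list_of_set (fvars \<phi>)) \<phi>"

record ('f, 'r, 'a) fo_structure =
  universe :: "'a set"
  fun_int :: "'f \<Rightarrow> 'a list \<Rightarrow> 'a"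
  rel_int :: "'r \<Rightarrow> 'a list set"

text \<open>A vocabulary is given by its function symbols (constants have arity \<open>0\<close>) and its relation
  symbols, each paired with its arity. Values at symbols outside the vocabulary are irrelevant.\<close>

definition is_structure ::
  "('f \<times> nat) set \<Rightarrow> ('r \<times> nat) set \<Rightarrow> ('f, 'r, 'a) fo_structure \<Rightarrow> bool" where
  "is_structure Fs Rs M \<longleftrightarrow>
     universe M \<noteq> {} \<and>
     (\<forall>(f, n)\<in>Fs. \<forall>as. set as \<subseteq> universe M \<and> length as = n \<longrightarrow> fun_int M f as \<in> universe M) \<and>
     (\<forall>(r, n)\<in>Rs. rel_int M r \<subseteq> {as. set as \<subseteq> universe M \<and> length as = n})"

primrec tval :: "('f, 'r, 'a) fo_structure \<Rightarrow> (nat \<Rightarrow> 'a) \<Rightarrow> 'f tm \<Rightarrow> 'a" where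
  "tval M v (Var x) = v x"
| "tval M v (Fn f ts) = fun_int M f (map (tval M v) ts)"

primrec sat :: "('f, 'r, 'a) fo_structure \<Rightarrow> (nat \<Rightarrow> 'a) \<Rightarrow> ('f, 'r) fm \<Rightarrow> bool" where
  "sat M v Bot \<longleftrightarrow> False"
| "sat M v (Rel r ts) \<longleftrightarrow> map (tval M v) ts \<in> rel_int M r"
| "sat M v (Eq s t) \<longleftrightarrow> tval M v s = tval M v t"
| "sat M v (Neg \<phi>) \<longleftrightarrow> \<not> sat M v \<phi>"
| "sat M v (And \<phi> \<psi>) \<longleftrightarrow> sat M v \<phi> \<and> sat M v \<psi>"
| "sat M v (Or \<phi> \<psi>) \<longleftrightarrow> sat M v \<phi> \<or> sat M v \<psi>"
| "sat M v (Imp \<phi> \<psi>) \<longleftrightarrow> (sat M v \<phi> \<longrightarrow> sat M v \<psi>)"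
| "sat M v (Forall x \<phi>) \<longleftrightarrow> (\<forall>a\<in>universe M. sat M (v(x := a)) \<phi>)"
| "sat M v (Exists x \<phi>) \<longleftrightarrow> (\<exists>a\<in>universe M. sat M (v(x := a)) \<phi>)"

definition models :: "('f, 'r, 'a) fo_structure \<Rightarrow> ('f, 'r) fm set \<Rightarrow> bool" where
  "models M S \<longleftrightarrow> (\<forall>\<phi>\<in>S. \<forall>v. range v \<subseteq> universe M \<longrightarrow> sat M v \<phi>)"


section \<open>The first-order encoding\<close>

text \<open>The constant \<open>e\<close> is the constructor \<open>EC\<close>, hence automatically different from every
  constant \<open>St q\<close> as a symbol.\<close>

datatype 'q fsym = St 'q | EC | Mult

datatype 'q rsym = InS | RS | PS "'q set"

definition all_sets :: "'q rule set \<Rightarrow> 'q set set" where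
  "all_sets T = {J. \<exists>I q q'. Guarded (AllG I J) q q' \<in> T}"

definition vocab_funs :: "'q set \<Rightarrow> ('q fsym \<times> nat) set" where
  "vocab_funs Q = {(St q, 0) | q. q \<in> Q} \<union> {(EC, 0), (Mult, 2)}"

definition vocab_rels :: "'q rule set \<Rightarrow> ('q rsym \<times> nat) set" where
  "vocab_rels T = {(InS, 1), (RS, 1)} \<union> {(PS J, 1) | J. J \<in> all_sets T}"

abbreviation cE :: "'q fsym tm" where "cE \<equiv> Fn EC []"
abbreviation cQ :: "'q \<Rightarrow> 'q fsym tm" where "cQ q \<equiv> Fn (St q) []"
abbreviation mul :: "'q fsym tm \<Rightarrow> 'q fsym tm \<Rightarrow> 'q fsym tm" (infixl "\<star>" 70)
  where "s \<star> t \<equiv> Fn Mult [s, t]"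
abbreviation InF :: "'q fsym tm \<Rightarrow> ('q fsym, 'q rsym) fm" where "InF t \<equiv> Rel InS [t]"
abbreviation RF :: "'q fsym tm \<Rightarrow> ('q fsym, 'q rsym) fm" where "RF t \<equiv> Rel RS [t]"
abbreviation PF :: "'q set \<Rightarrow> 'q fsym tm \<Rightarrow> ('q fsym, 'q rsym) fm" where "PF J t \<equiv> Rel (PS J) [t]"

abbreviation vx :: "'q fsym tm" where "vx \<equiv> Var 0"
abbreviation vy :: "'q fsym tm" where "vy \<equiv> Var 1"
abbreviation vz :: "'q fsym tm" where "vz \<equiv> Var 2"
abbreviation vw :: "'q fsym tm" where "vw \<equiv> Var 3"

definition monoid_axioms :: "('q fsym, 'q rsym) fm set" where
  "monoid_axioms =
     {Eq ((vx \<star> vy) \<star> vz) (vx \<star> (vy \<star> vz)), Eq (cE \<star> vx) vx, Eq (vx \<star> cE) vx}"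

definition init_axioms :: "'q \<Rightarrow> ('q fsym, 'q rsym) fm set" where
  "init_axioms q0 = {InF cE, Imp (InF vx) (InF (vx \<star> cQ q0)), Imp (InF vx) (RF vx)}"

definition pred_axioms :: "'q set \<Rightarrow> ('q fsym, 'q rsym) fm set" where
  "pred_axioms J = insert (PF J cE) {Imp (PF J vx) (PF J (vx \<star> cQ q)) | q. q \<in> J}"

fun guard_fms :: "'q guard \<Rightarrow> ('q fsym, 'q rsym) fm set" where
  "guard_fms (AllG L J) = {PF J vx}"
| "guard_fms (AllG R J) = {PF J vy}"
| "guard_fms (AllG LR J) = {And (PF J vx) (PF J vy)}"
| "guard_fms (ExG L J) = {Eq vx ((vz \<star> cQ q) \<star> vw) | q. q \<in> J}"
| "guard_fms (ExG R J) = {Eq vy ((vz \<star> cQ q) \<star> vw) | q. q \<in> J}"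
| "guard_fms (ExG LR J) =
     {Or (Eq vx ((vz \<star> cQ q) \<star> vw)) (Eq vy ((vz \<star> cQ q) \<star> vw)) | q. q \<in> J}"

fun rule_axioms :: "'q rule \<Rightarrow> ('q fsym, 'q rsym) fm set" where
  "rule_axioms (Free q1 q2) = {Imp (RF ((vx \<star> cQ q1) \<star> vy)) (RF ((vx \<star> cQ q2) \<star> vy))}"
| "rule_axioms (Guarded G q1 q2) =
     {Imp (And (RF ((vx \<star> cQ q1) \<star> vy)) \<gamma>) (RF ((vx \<star> cQ q2) \<star> vy)) | \<gamma>. \<gamma> \<in> guard_fms G}"

definition Phi :: "'q rule set \<Rightarrow> 'q \<Rightarrow> ('q fsym, 'q rsym) fm set" where
  "Phi T q0 = all_closure `
     (monoid_axioms \<union> init_axioms q0 \<union> (\<Union>J\<in>all_sets T. pred_axioms J) \<union> (\<Union>r\<in>T. rule_axioms r))"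

definition psi :: "'q list \<Rightarrow> ('q fsym, 'q rsym) fm" where
  "psi w = RF (foldl (\<lambda>t i. (t \<star> cQ (w ! i)) \<star> Var (Suc i)) (Var 0) [0..<length w])"

text \<open>The order of the disjuncts is an arbitrary enumeration of the finite set \<open>F\<close>. Different
  disjuncts share variables; they are all bound by the existential closure.\<close>

definition Psi :: "'q list set \<Rightarrow> ('q fsym, 'q rsym) fm" where
  "Psi F = ex_closure (foldr Or (map psi (SOME ws. set ws = F)) Bot)"

end

(*
  Every set in the backward iteration is the upward closure of words of bounded length: if U is
  generated by words of length at most m, then Pre(U) is generated by words of length at most m + 2,
  since of a predecessor one needs to keep only the embedded generator, the active position and one
  witness of an existential guard. Hence the fixed point U is a union of classes of the congruence
  "same subwords of length at most m", which has finite index. The finite model is the quotient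
  monoid, with R the image of the complement of U, In the image of the initial words and P^J the
  image of the words over J. Because U is saturated and closed under Pre, a rule axiom can be
  checked on representatives that satisfy the guard as words.
*)
theory Submission imports Defs begin

section \<open>Steps by word decomposition\<close>

text \<open>\<open>x\<close> and \<open>y\<close> are the words left and right of the active letter.
  \<open>I \<noteq> R\<close> says that the scope covers the left side, \<open>I \<noteq> L\<close>
  that it covers the right side.\<close>

fun guard_split :: "'q list \<Rightarrow> 'q list \<Rightarrow> 'q guard \<Rightarrow> bool" where
  "guard_split x y (AllG I J) \<longleftrightarrow> (I \<noteq> R \<longrightarrow> set x \<subseteq> J) \<and> (I \<noteq> L \<longrightarrow> set y \<subseteq> J)"
| "guard_split x y (ExG I J) \<longleftrightarrow> (I \<noteq> R \<and> set x \<inter> J \<noteq> {}) \<or> (I \<noteq> L \<and> set y \<inter> J \<noteq> {})"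

lemma all_left_split: "(\<forall>k<length x. (x @ q # y) ! k \<in> J) \<longleftrightarrow> set x \<subseteq> J"
  by (auto simp: nth_append set_conv_nth)

lemma all_right_split:
  "(\<forall>k. length x < k \<and> k < length (x @ q # y) \<longrightarrow> (x @ q # y) ! k \<in> J) \<longleftrightarrow> set y \<subseteq> J"
  (is "?lhs \<longleftrightarrow> ?rhs")
proof
  assume l: ?lhs
  show ?rhs
  proof
    fix a assume "a \<in> set y"
    then obtain i where "i < length y" "y ! i = a" by (auto simp: in_set_conv_nth)
    \<comment> \<open>The active letter occupies position \<open>length x\<close>, so letter
      \<open>i\<close> of \<open>y\<close> sits one place beyond
      \<open>length x + i\<close>.\<close>
    then show "a \<in> J" using l[rule_format, of "length x + Suc i"] by (simp add: nth_append)
  qed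
next
  assume r: ?rhs
  show ?lhs
  proof (intro allI impI)
    fix k assume k: "length x < k \<and> k < length (x @ q # y)"
    then obtain i where "k = Suc (length x + i)" by (auto dest: less_imp_Suc_add)
    with k r show "(x @ q # y) ! k \<in> J" by (auto simp: nth_append)
  qed
qed

text \<open>Existential conditions on \<open>J\<close> are negated universal conditions on the
  complement of \<open>J\<close>.\<close>

lemma ex_left_split: "(\<exists>k<length x. (x @ q # y) ! k \<in> J) \<longleftrightarrow> set x \<inter> J \<noteq> {}"
  using all_left_split[of x q y "- J"] by blast

lemma ex_right_split:
  "(\<exists>k. length x < k \<and> k < length (x @ q # y) \<and> (x @ q # y) ! k \<in> J) \<longleftrightarrow> set y \<inter> J \<noteq> {}"
  using all_right_split[of x q y "- J"] by blast

lemma guard_holds_split: "guard_holds (x @ q # y) (length x) G \<longleftrightarrow> guard_split x y G"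
proof (cases G)
  case (AllG I J)
  then show ?thesis
    by (cases I) (simp_all only: guard_holds.simps guard_split.simps
        all_left_split all_right_split scope.simps simp_thms)
next
  case (ExG I J)
  then show ?thesis
    by (cases I) (simp_all only: guard_holds.simps guard_split.simps
        ex_left_split ex_right_split scope.simps simp_thms)
qed

text \<open>A guard never inspects the active letter, so applicability is a property of the two
  contexts, which can then be shrunk separately.\<close>

definition enabled :: "'q rule set \<Rightarrow> 'q list \<Rightarrow> 'q list \<Rightarrow> 'q \<Rightarrow> 'q \<Rightarrow> bool" where
  "enabled T x y q q' \<longleftrightarrow>
     Free q q' \<in> T \<or> (\<exists>G. Guarded G q q' \<in> T \<and> guard_split x y G)"

lemma step_enabledI:
  assumes "enabled T x y q q'"
  shows "step T (x @ q # y) (x @ q' # y)"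
proof -
  have "Free q q' \<in> T \<or> (\<exists>G. Guarded G q q' \<in> T \<and> guard_holds (x @ q # y) (length x) G)"
    using assms by (simp add: enabled_def guard_holds_split)
  moreover have "(x @ q' # y) ! j = (x @ q # y) ! j" if "j \<noteq> length x" for j
    using that by (simp add: nth_append nth_Cons')
  ultimately show ?thesis
    unfolding step_def by (intro conjI exI[of _ "length x"]) simp_all
qed

lemma step_enabledE:
  assumes "step T c c'"
  obtains x y q q' where "c = x @ q # y" "c' = x @ q' # y" "enabled T x y q q'"
proof -
  from assms obtain i q q' where len: "length c' = length c" and i: "i < length c"
    and r: "Free q q' \<in> T \<or> (\<exists>G. Guarded G q q' \<in> T \<and> guard_holds c i G)"
    and q: "c ! i = q" "c' ! i = q'" and same: "\<forall>j<length c. j \<noteq> i \<longrightarrow> c' ! j = c ! j"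
    unfolding step_def by blast
  define x y where "x = take i c" and "y = drop (Suc i) c"
  have c: "c = x @ q # y"
    using id_take_nth_drop[OF i] q by (simp add: x_def y_def)
  have "c' = c[i := q']"
    using len i q same by (intro nth_equalityI) (auto simp: nth_list_update)
  then have c': "c' = x @ q' # y"
    using i by (simp add: x_def y_def upd_conv_take_nth_drop)
  have "i = length x" using i by (simp add: x_def)
  with r c have "enabled T x y q q'" by (simp add: enabled_def guard_holds_split)
  with c c' show thesis using that by blast
qed

section \<open>Shrinking the contexts of an enabled rule\<close>

lemma subseq_in_lists: "subseq u w \<Longrightarrow> w \<in> lists A \<Longrightarrow> u \<in> lists A"
  by (induction rule: list_emb.induct) auto

text \<open>Cut \<open>x\<close> at an occurrence of \<open>q\<close>, and \<open>b\<close>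
  accordingly into \<open>b1\<close> and \<open>b2\<close>. If \<open>b2\<close> embeds after that
  occurrence, \<open>q\<close> can be inserted between them; otherwise \<open>b2\<close> starts with
  \<open>q\<close> and \<open>b\<close> already contains it.\<close>

lemma subseq_insert_letter:
  assumes "subseq b x" and "q \<in> set x"
  shows "\<exists>b'. subseq b b' \<and> subseq b' x \<and> q \<in> set b' \<and> length b' \<le> Suc (length b)"
proof -
  from assms(2) obtain x1 x2 where x: "x = x1 @ q # x2" by (meson split_list)
  with assms(1) obtain b1 b2 where b: "b = b1 @ b2" "subseq b1 x1" "subseq b2 (q # x2)"
    by (auto simp: subseq_append_iff)
  show ?thesis
  proof (cases "subseq b2 x2")
    case True
    then show ?thesis
      using b x by (intro exI[of _ "b1 @ q # b2"]) (auto intro: list_emb_append_mono)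
  next
    case False
    with b(3) obtain b3 where "b2 = q # b3" by (cases b2) (auto split: if_splits)
    then show ?thesis using b x by (intro exI[of _ b]) (auto intro: list_emb_append_mono)
  qed
qed

text \<open>Universal guards pass to subwords at no cost. An existential guard needs a single
  witness, kept on one side only, which accounts for the one additional letter.\<close>

lemma guard_split_shrink:
  assumes "guard_split x y G" and "subseq b x" and "subseq d y"
  shows "\<exists>b' d'. subseq b b' \<and> subseq b' x \<and> subseq d d' \<and> subseq d' y \<and> guard_split b' d' G \<and>
    length b' + length d' \<le> Suc (length b + length d)"
proof (cases G)
  case (AllG I J)
  have "set b \<subseteq> set x" "set d \<subseteq> set y" using assms(2,3) by (auto dest: list_emb_set)
  with assms AllG show ?thesis by (intro exI[of _ b] exI[of _ d]) auto
next
  case (ExG I J)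
  with assms(1) consider q where "I \<noteq> R" "q \<in> set x" "q \<in> J" | q where "I \<noteq> L" "q \<in> set y" "q \<in> J"
    by auto
  then show ?thesis
  proof cases
    case 1
    with subseq_insert_letter[OF assms(2)] obtain b' where
      "subseq b b'" "subseq b' x" "q \<in> set b'" "length b' \<le> Suc (length b)" by blast
    with 1 assms(3) ExG show ?thesis by (intro exI[of _ b'] exI[of _ d]) auto
  next
    case 2
    with subseq_insert_letter[OF assms(3)] obtain d' where
      "subseq d d'" "subseq d' y" "q \<in> set d'" "length d' \<le> Suc (length d)" by blast
    with 2 assms(2) ExG show ?thesis by (intro exI[of _ b] exI[of _ d']) auto
  qed
qed

lemma enabled_shrink:
  assumes "enabled T x y q q'" and "subseq b x" and "subseq d y"
  shows "\<exists>b' d'. subseq b b' \<and> subseq b' x \<and> subseq d d' \<and> subseq d' y \<and> enabled T b' d' q q' \<and>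
    length b' + length d' \<le> Suc (length b + length d)"
  using assms(1)[unfolded enabled_def]
proof (elim disjE exE conjE)
  assume "Free q q' \<in> T"
  with assms(2,3) show ?thesis unfolding enabled_def by (intro exI[of _ b] exI[of _ d]) auto
next
  fix G assume "Guarded G q q' \<in> T" "guard_split x y G"
  with guard_split_shrink[OF _ assms(2,3), of G] show ?thesis unfolding enabled_def by blast
qed


section \<open>Upward closed sets with bounded generators\<close>

definition up_closed :: "'q set \<Rightarrow> 'q list set \<Rightarrow> bool" where
  "up_closed Q U \<longleftrightarrow> U \<subseteq> lists Q \<and> (\<forall>u\<in>U. \<forall>w\<in>lists Q. subseq u w \<longrightarrow> w \<in> U)"

definition generated_upto :: "nat \<Rightarrow> 'q list set \<Rightarrow> bool" where
  "generated_upto m U \<longleftrightarrow> (\<forall>u\<in>U. \<exists>b\<in>U. subseq b u \<and> length b \<le> m)"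

text \<open>No closure of \<open>U\<close> is involved: an abstract step may first delete letters,
  so a larger word can delete down to whatever the smaller one used.\<close>

lemma up_closed_Pre: "up_closed Q (Pre Q T U)"
  unfolding up_closed_def Pre_def abs_step_def by (auto intro: subseq_order.order_trans)

text \<open>A predecessor is cut down to a small word that still steps above a generator of
  \<open>U\<close>; the cost is the active letter and one guard witness.\<close>

lemma generated_upto_Pre:
  assumes U: "up_closed Q U" and gen: "generated_upto m U"
  shows "generated_upto (m + 2) (Pre Q T U)"
  unfolding generated_upto_def
proof
  fix c assume "c \<in> Pre Q T U"
  then obtain c1 c' where c: "c \<in> lists Q" "subseq c1 c" "step T c1 c'" "c' \<in> U"
    by (auto simp: Pre_def abs_step_def)
  from c(3) obtain x y q q' where xy: "c1 = x @ q # y" "c' = x @ q' # y" "enabled T x y q q'"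
    by (rule step_enabledE)
  from gen c(4) obtain b where b: "b \<in> U" "subseq b c'" "length b \<le> m"
    by (auto simp: generated_upto_def)
  \<comment> \<open>The generator is cut along \<open>c'\<close>. Its middle part \<open>b2\<close>
    is empty or \<open>[q']\<close>.\<close>
  from b(2) xy(2) obtain b1 b2 b3 where split: "b = b1 @ b2 @ b3"
    "subseq b1 x" "subseq b2 [q']" "subseq b3 y"
    using subseq_append_iff[of b x "q' # y"] subseq_append_iff[of _ "[q']" y] by auto
  from enabled_shrink[OF xy(3) split(2,4)] obtain d1 d3 where d:
    "subseq b1 d1" "subseq d1 x" "subseq b3 d3" "subseq d3 y" "enabled T d1 d3 q q'"
    "length d1 + length d3 \<le> Suc (length b1 + length b3)" by blast
  let ?d = "d1 @ q # d3" and ?d' = "d1 @ q' # d3"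
  have "c1 \<in> lists Q" using c(2,1) by (rule subseq_in_lists)
  have sub: "subseq ?d c1" using d xy by (auto intro: list_emb_append_mono)
  then have dc: "subseq ?d c" using c(2) subseq_order.order_trans by blast
  have dQ: "?d \<in> lists Q" using dc c(1) by (rule subseq_in_lists)
  have "subseq ?d' c'" using d xy by (auto intro: list_emb_append_mono)
  moreover have "c' \<in> lists Q" using c(4) U by (auto simp: up_closed_def)
  ultimately have d'Q: "?d' \<in> lists Q" by (rule subseq_in_lists)
  \<comment> \<open>The successor of the small word still contains the generator, hence lies in the
    upward closed set \<open>U\<close>.\<close>
  have "subseq b (d1 @ [q'] @ d3)" unfolding split(1)
    using d split by (intro list_emb_append_mono)
  with d'Q b(1) U have "?d' \<in> U" by (auto simp: up_closed_def)
  with step_enabledI[OF d(5)] dQ have "?d \<in> Pre Q T U" by (auto simp: Pre_def abs_step_def)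
  \<comment> \<open>If \<open>b2\<close> is empty, the active letter \<open>q\<close> is new; a
    guard witness may add another letter, hence two in the worst case.\<close>
  moreover have "length ?d \<le> m + 2" using d(6) b(3) split(1) by simp
  ultimately show "\<exists>b\<in>Pre Q T U. subseq b c \<and> length b \<le> m + 2" using dc by blast
qed

lemma up_closed_Un: "up_closed Q U \<Longrightarrow> up_closed Q V \<Longrightarrow> up_closed Q (U \<union> V)"
  unfolding up_closed_def by blast

lemma generated_upto_Un:
  assumes "generated_upto m U" and "generated_upto k V" and "m \<le> k"
  shows "generated_upto k (U \<union> V)"
  unfolding generated_upto_def
proof
  fix u assume "u \<in> U \<union> V"
  then obtain b where "b \<in> U \<union> V" "subseq b u" "length b \<le> m \<or> length b \<le> k"
    using assms(1,2) unfolding generated_upto_def by blast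
  with assms(3) show "\<exists>b\<in>U \<union> V. subseq b u \<and> length b \<le> k" by fastforce
qed

lemma backward_iter_generated:
  assumes "up_closed Q B" and "generated_upto m B"
  shows "up_closed Q (backward_iter Q T B i) \<and>
    generated_upto (m + 2 * i) (backward_iter Q T B i)"
proof (induction i)
  case (Suc i)
  then have "generated_upto (m + 2 * i + 2) (backward_iter Q T B i \<union> Pre Q T (backward_iter Q T B i))"
    by (intro generated_upto_Un[of "m + 2 * i"] generated_upto_Pre) auto
  with Suc show ?case by (simp add: up_closed_Un up_closed_Pre)
qed (use assms in simp)

lemma bad_configs_generated:
  assumes "finite F" and "F \<subseteq> lists Q"
  shows "up_closed Q (bad_configs Q F) \<and> generated_upto (Max (length ` F)) (bad_configs Q F)"
proof
  show "up_closed Q (bad_configs Q F)"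
    unfolding up_closed_def bad_configs_def by (auto intro: subseq_order.order_trans)
  show "generated_upto (Max (length ` F)) (bad_configs Q F)"
    unfolding generated_upto_def
  proof
    fix u assume "u \<in> bad_configs Q F"
    then obtain w where "w \<in> F" "subseq w u" by (auto simp: bad_configs_def)
    moreover from this have "w \<in> bad_configs Q F" using assms by (auto simp: bad_configs_def)
    \<comment> \<open>For empty \<open>F\<close> the maximum is unspecified, but then there is no
      bad word; here \<open>w\<close> shows that \<open>F\<close> is nonempty.\<close>
    moreover have "length w \<le> Max (length ` F)" using assms(1) \<open>w \<in> F\<close> by simp
    ultimately show "\<exists>b\<in>bad_configs Q F. subseq b u \<and> length b \<le> Max (length ` F)" by blast
  qed
qed


section \<open>The congruence of equal short subwords\<close>

text \<open>Equality of these sets is Simon's congruence of level \<open>m\<close>, known from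
  piecewise testable languages.\<close>

definition short_subwords :: "nat \<Rightarrow> 'q list \<Rightarrow> 'q list set" where
  "short_subwords m w = {s. subseq s w \<and> length s \<le> m}"

text \<open>A subword of a concatenation splits into two pieces, neither longer than the whole.
  Applied in both directions, this makes equality of short subwords a congruence.\<close>

lemma short_subwords_append_mono:
  assumes "short_subwords m u \<subseteq> short_subwords m u'" and "short_subwords m v \<subseteq> short_subwords m v'"
  shows "short_subwords m (u @ v) \<subseteq> short_subwords m (u' @ v')"
proof
  fix s assume "s \<in> short_subwords m (u @ v)"
  then obtain a b where s: "s = a @ b" "subseq a u" "subseq b v" "length s \<le> m"
    by (auto simp: short_subwords_def subseq_append_iff)
  then have "a \<in> short_subwords m u'" "b \<in> short_subwords m v'"
    using assms by (auto simp: short_subwords_def)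
  with s show "s \<in> short_subwords m (u' @ v')"
    by (auto simp: short_subwords_def intro: list_emb_append_mono)
qed

lemma finite_short_subwords_image:
  assumes "finite Q"
  shows "finite (short_subwords m ` lists Q)"
proof (rule finite_subset)
  show "short_subwords m ` lists Q \<subseteq> Pow {xs. set xs \<subseteq> Q \<and> length xs \<le> m}"
    by (auto simp: short_subwords_def dest: list_emb_set)
  show "finite (Pow {xs. set xs \<subseteq> Q \<and> length xs \<le> m})"
    using finite_lists_length_le[OF assms] by simp
qed

text \<open>Membership of \<open>u\<close> is certified by a generator short enough to be seen by
  the congruence, so it is a subword of \<open>v\<close> too.\<close>

lemma short_subwords_saturated:
  assumes "up_closed Q U" and "generated_upto m U"
    and "u \<in> U" and "v \<in> lists Q" and "short_subwords m u = short_subwords m v"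
  shows "v \<in> U"
proof -
  from assms(2,3) obtain b where b: "b \<in> U" "subseq b u" "length b \<le> m"
    by (auto simp: generated_upto_def)
  then have "b \<in> short_subwords m v" using assms(5) by (auto simp: short_subwords_def)
  with b assms(1,4) show ?thesis by (auto simp: short_subwords_def up_closed_def)
qed


section \<open>The quotient structure\<close>

lemma sat_foldr_Forall:
  assumes "\<And>v. range v \<subseteq> universe M \<Longrightarrow> sat M v \<phi>" and "range v \<subseteq> universe M"
  shows "sat M v (foldr Forall xs \<phi>)"
  using assms(2)
proof (induction xs arbitrary: v)
  case (Cons x xs)
  have "range (v(x := a)) \<subseteq> universe M" if "a \<in> universe M" for a
    using Cons.prems that by auto
  with Cons.IH show ?case by simp
qed (use assms(1) in simp)

lemma not_sat_foldr_Exists: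
  assumes "\<And>v. range v \<subseteq> universe M \<Longrightarrow> \<not> sat M v \<phi>" and "range v \<subseteq> universe M"
  shows "\<not> sat M v (foldr Exists xs \<phi>)"
  using assms(2)
proof (induction xs arbitrary: v)
  case (Cons x xs)
  have "range (v(x := a)) \<subseteq> universe M" if "a \<in> universe M" for a
    using Cons.prems that by auto
  with Cons.IH show ?case by simp
qed (use assms(1) in simp)

lemma sat_foldr_Or: "sat M v (foldr Or \<phi>s Bot) \<longleftrightarrow> (\<exists>\<phi>\<in>set \<phi>s. sat M v \<phi>)"
  by (induction \<phi>s) auto

text \<open>Only the kernel of \<open>h\<close> matters: it is a congruence on words over
  \<open>Q\<close>, and \<open>U\<close> is a union of its classes. The values of \<open>h\<close>
  are mere names of classes, so they can later be natural numbers.\<close>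

locale recognizing_quotient =
  fixes Q :: "'q set" and U :: "'q list set" and h :: "'q list \<Rightarrow> 'a"
  assumes congruence: "\<lbrakk>u \<in> lists Q; u' \<in> lists Q; v \<in> lists Q; v' \<in> lists Q; h u = h u'; h v = h v'\<rbrakk>
      \<Longrightarrow> h (u @ v) = h (u' @ v')"
    and saturated: "\<lbrakk>u \<in> lists Q; v \<in> lists Q; h u = h v; u \<in> U\<rbrakk> \<Longrightarrow> v \<in> U"
begin

definition rep :: "'a \<Rightarrow> 'q list" where
  "rep = inv_into (lists Q) h"

fun quotient_fun :: "'q fsym \<Rightarrow> 'a list \<Rightarrow> 'a" where
  "quotient_fun (St q) as = h [q]"
| "quotient_fun EC as = h []"
| "quotient_fun Mult as = h (rep (as ! 0) @ rep (as ! 1))"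

text \<open>All three relations are images: a class belongs to one as soon as some representative
  does. For \<open>InS\<close> and \<open>PS J\<close> other representatives may fail, so proofs
  about these must choose the right one.\<close>

fun quotient_rel :: "'q \<Rightarrow> 'q rsym \<Rightarrow> 'a list set" where
  "quotient_rel q0 InS = (\<lambda>w. [h w]) ` init_configs q0"
| "quotient_rel q0 RS = (\<lambda>w. [h w]) ` (lists Q - U)"
| "quotient_rel q0 (PS J) = (\<lambda>w. [h w]) ` lists J"

definition quotient :: "'q \<Rightarrow> ('q fsym, 'q rsym, 'a) fo_structure" where
  "quotient q0 = \<lparr>universe = h ` lists Q, fun_int = quotient_fun, rel_int = quotient_rel q0\<rparr>"

lemma rep: "a \<in> h ` lists Q \<Longrightarrow> rep a \<in> lists Q \<and> h (rep a) = a"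
  unfolding rep_def by (simp add: inv_into_into f_inv_into_f)

lemma quotient_Mult:
  assumes "u \<in> lists Q" and "v \<in> lists Q"
  shows "quotient_fun Mult [h u, h v] = h (u @ v)"
  using assms rep[of "h u"] rep[of "h v"] by (auto intro!: congruence)

declare quotient_fun.simps(3) [simp del]
declare quotient_Mult [simp]

text \<open>By saturation of \<open>U\<close>, the relation \<open>RS\<close> can be tested on any
  representative.\<close>

lemma quotient_R_iff: "w \<in> lists Q \<Longrightarrow> [h w] \<in> quotient_rel q0 RS \<longleftrightarrow> w \<notin> U"
  using saturated by (auto simp: image_iff)

lemma is_structure_quotient:
  assumes "q0 \<in> Q" and "\<And>J. J \<in> all_sets T \<Longrightarrow> J \<subseteq> Q"
  shows "is_structure (vocab_funs Q) (vocab_rels T) (quotient q0)"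
proof -
  have "quotient_fun Mult as \<in> h ` lists Q" if "set as \<subseteq> h ` lists Q" "length as = 2" for as
  proof -
    from that obtain u v where uv: "as = [h u, h v]" "u \<in> lists Q" "v \<in> lists Q"
      by (auto simp: numeral_2_eq_2 length_Suc_conv simp del: in_lists_conv_set del: in_listsD in_listsI)
    then have "quotient_fun Mult as = h (u @ v)" by (simp only: quotient_Mult)
    moreover have "u @ v \<in> lists Q" using uv by simp
    ultimately show ?thesis by (simp only: imageI)
  qed
  moreover have "h [] \<in> h ` lists Q" "h [q] \<in> h ` lists Q" if "q \<in> Q" for q
    using that by (intro imageI; simp)+
  ultimately have funs: "quotient_fun f as \<in> h ` lists Q"
    if "(f, n) \<in> vocab_funs Q" "set as \<subseteq> h ` lists Q" "length as = n" for f n as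
    using that assms(1) by (auto simp: vocab_funs_def simp del: in_lists_conv_set)
  have rels: "quotient_rel q0 r \<subseteq> {as. set as \<subseteq> h ` lists Q \<and> length as = n}"
    if "(r, n) \<in> vocab_rels T" for r n
  proof -
    \<comment> \<open>Being an image of words over \<open>Q\<close> under
      \<open>\<lambda>w. [h w]\<close> yields both arity one and membership in the universe.\<close>
    have "\<exists>A\<subseteq>lists Q. quotient_rel q0 r = (\<lambda>w. [h w]) ` A"
    proof (cases r)
      case InS
      have "init_configs q0 \<subseteq> lists Q" using assms(1) by (auto simp: init_configs_def)
      then show ?thesis unfolding InS quotient_rel.simps by blast
    next
      case RS
      show ?thesis unfolding RS quotient_rel.simps by (intro exI[of _ "lists Q - U"]) simp
    next
      case (PS J)
      with that assms(2) have "lists J \<subseteq> lists Q"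
        by (intro lists_mono) (auto simp: vocab_rels_def)
      then show ?thesis unfolding PS quotient_rel.simps by blast
    qed
    then obtain A where A: "A \<subseteq> lists Q" "quotient_rel q0 r = (\<lambda>w. [h w]) ` A" by blast
    have "n = 1" using that by (auto simp: vocab_rels_def)
    with A show ?thesis by (auto simp del: in_lists_conv_set del: in_listsI)
  qed
  show ?thesis
    unfolding is_structure_def quotient_def fo_structure.simps using funs rels by blast
qed

section \<open>Rule axioms\<close>

text \<open>Truth of a guard formula is a statement about classes; it is lifted to words by choosing
  representatives. \<open>PS J\<close> supplies one over \<open>J\<close>, and an existential
  equation supplies one containing a letter of \<open>J\<close>.\<close>

lemma sat_guard_witness:
  assumes "\<gamma> \<in> guard_fms G" and "sat (quotient q0) v \<gamma>" and "range v \<subseteq> h ` lists Q"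
    and "guard_set G \<subseteq> Q"
  shows "\<exists>x\<in>lists Q. \<exists>y\<in>lists Q. v 0 = h x \<and> v 1 = h y \<and> guard_split x y G"
proof -
  from assms(3) have "\<forall>i. \<exists>w. v i = h w \<and> w \<in> lists Q" by blast
  then obtain \<rho> where \<rho>: "\<And>i. v i = h (\<rho> i)" "\<And>i. \<rho> i \<in> lists Q" by metis
  show ?thesis
  proof (cases G)
    case (AllG I J)
    then have J: "lists J \<subseteq> lists Q" using assms(4) by (simp add: lists_mono)
    \<comment> \<open>The flag \<open>b\<close> records whether the scope constrains this side; on
      an unconstrained side any representative will do.\<close>
    have pick: "\<exists>w\<in>lists Q. v i = h w \<and> (b \<longrightarrow> set w \<subseteq> J)" if "b \<Longrightarrow> v i \<in> h ` lists J" for i b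
    proof (cases b)
      case True
      with that obtain w where "w \<in> lists J" "v i = h w" by blast
      with J show ?thesis by blast
    next
      case False
      with \<rho> show ?thesis by blast
    qed
    have "I \<noteq> R \<Longrightarrow> v 0 \<in> h ` lists J" "I \<noteq> L \<Longrightarrow> v 1 \<in> h ` lists J"
      using assms(1,2) AllG by (cases I; auto simp: quotient_def)+
    from pick[OF this(1)] pick[OF this(2)] show ?thesis
      unfolding AllG guard_split.simps by blast
  next
    case (ExG I J)
    from assms(1,2) ExG obtain q where q: "q \<in> J"
      "I \<noteq> R \<and> v 0 = quotient_fun Mult [quotient_fun Mult [v 2, h [q]], v 3] \<or>
       I \<noteq> L \<and> v 1 = quotient_fun Mult [quotient_fun Mult [v 2, h [q]], v 3]"
      by (cases I) (auto simp: quotient_def)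
    \<comment> \<open>The word behind the right-hand side of the guard equation; it replaces the
      arbitrary representative of the constrained variable.\<close>
    define z where "z = (\<rho> 2 @ [q]) @ \<rho> 3"
    have "q \<in> Q" using q(1) assms(4) ExG by auto
    then have "quotient_fun Mult [quotient_fun Mult [v 2, h [q]], v 3] = h z"
      unfolding \<rho>(1) z_def using \<rho>(2) by (simp del: append_assoc)
    moreover have z: "z \<in> lists Q" "set z \<inter> J \<noteq> {}"
      unfolding z_def using \<rho>(2) \<open>q \<in> Q\<close> q(1) by auto
    ultimately consider "I \<noteq> R" "v 0 = h z" | "I \<noteq> L" "v 1 = h z" using q(2) by metis
    then show ?thesis
      unfolding ExG guard_split.simps using \<rho> z by cases blast+
  qed
qed

text \<open>By contraposition: if the rewritten word were in \<open>U\<close>, the original word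
  would be in \<open>Pre Q T U\<close> and hence in \<open>U\<close>. The words may be built from
  guard-satisfying representatives because \<open>RS\<close> does not depend on the choice.\<close>

lemma sat_rule_axioms:
  assumes closed: "Pre Q T U \<subseteq> U" and r: "r \<in> T" "rule_over Q r" and \<phi>: "\<phi> \<in> rule_axioms r"
    and v: "range v \<subseteq> h ` lists Q"
  shows "sat (quotient q0) v \<phi>"
proof -
  have main: "[quotient_fun Mult [quotient_fun Mult [v 0, h [q']], v 1]] \<in> quotient_rel q0 RS"
    if "[quotient_fun Mult [quotient_fun Mult [v 0, h [q]], v 1]] \<in> quotient_rel q0 RS"
      "x \<in> lists Q" "y \<in> lists Q" "v 0 = h x" "v 1 = h y" "q \<in> Q" "q' \<in> Q" "enabled T x y q q'"
    for x y q q'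
  proof -
    from that have "x @ q # y \<notin> U"
      using quotient_R_iff[of "x @ q # y"] by (simp del: quotient_rel.simps)
    moreover have "x @ q # y \<in> Pre Q T U" if "x @ q' # y \<in> U"
      using that step_enabledI[OF \<open>enabled T x y q q'\<close>] \<open>x \<in> lists Q\<close> \<open>y \<in> lists Q\<close> \<open>q \<in> Q\<close>
      by (auto simp: Pre_def abs_step_def)
    ultimately have "x @ q' # y \<notin> U" using closed by blast
    with that show ?thesis
      using quotient_R_iff[of "x @ q' # y"] by (simp del: quotient_rel.simps)
  qed
  show ?thesis
  proof (cases r)
    case (Free q q')
    from v obtain x y where "x \<in> lists Q" "y \<in> lists Q" "v 0 = h x" "v 1 = h y"
      by (metis (no_types, opaque_lifting) imageE range_subsetD)
    with main[of q x y q'] Free r \<phi> show ?thesis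
      by (auto simp: quotient_def enabled_def simp del: quotient_rel.simps)
  next
    case (Guarded G q q')
    then obtain \<gamma> where \<gamma>: "\<gamma> \<in> guard_fms G"
      "\<phi> = Imp (And (RF ((vx \<star> cQ q) \<star> vy)) \<gamma>) (RF ((vx \<star> cQ q') \<star> vy))" using \<phi> by auto
    show ?thesis unfolding \<gamma>(2) sat.simps
    proof (intro impI, elim conjE)
      assume R: "map (tval (quotient q0) v) [(vx \<star> cQ q) \<star> vy] \<in> rel_int (quotient q0) RS"
        and "sat (quotient q0) v \<gamma>"
      with sat_guard_witness[OF \<gamma>(1) _ v] r(2) Guarded obtain x y where
        "x \<in> lists Q" "y \<in> lists Q" "v 0 = h x" "v 1 = h y" "guard_split x y G"
        by auto blast
      with main[of q x y q'] Guarded r R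
      show "map (tval (quotient q0) v) [(vx \<star> cQ q') \<star> vy] \<in> rel_int (quotient q0) RS"
        by (auto simp: quotient_def enabled_def simp del: quotient_rel.simps)
    qed
  qed
qed

section \<open>Monoid, initial and predicate axioms\<close>

lemma sat_monoid_axioms:
  assumes "\<phi> \<in> monoid_axioms" and "range v \<subseteq> h ` lists Q"
  shows "sat (quotient q0) v \<phi>"
proof -
  from assms(2) have "\<forall>i. \<exists>w. v i = h w \<and> w \<in> lists Q" by blast
  then obtain \<rho> where \<rho>: "\<And>i. v i = h (\<rho> i)" "\<And>i. \<rho> i \<in> lists Q" by metis
  have "quotient_fun Mult [h [], h w] = h w" "quotient_fun Mult [h w, h []] = h w"
    if "w \<in> lists Q" for w
    using that quotient_Mult[of "[]" w] quotient_Mult[of w "[]"] by simp_all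
  with assms(1) \<rho> show ?thesis by (auto simp: monoid_axioms_def quotient_def)
qed

lemma sat_init_axioms:
  assumes "\<phi> \<in> init_axioms q0" and "q0 \<in> Q" and "init_configs q0 \<inter> U = {}"
  shows "sat (quotient q0) v \<phi>"
proof -
  have sub: "replicate n q0 \<in> lists Q" "replicate n q0 \<notin> U" for n
    using assms(2,3) by (auto simp: init_configs_def)
  have app: "quotient_fun Mult [h (replicate n q0), h [q0]] = h (replicate (Suc n) q0)" for n
    using sub assms(2) by (simp add: replicate_append_same)
  have nil: "[] = replicate 0 q0" by simp
  from assms(1) consider "\<phi> = InF cE" | "\<phi> = Imp (InF vx) (InF (vx \<star> cQ q0))"
    | "\<phi> = Imp (InF vx) (RF vx)" by (auto simp: init_axioms_def)
  then show ?thesis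
  proof cases
    case 1
    then show ?thesis using nil by (auto simp: quotient_def init_configs_def)
  next
    case 2
    then show ?thesis using app by (auto simp: quotient_def init_configs_def simp del: replicate.simps)
  next
    case 3
    then show ?thesis using sub by (auto simp: quotient_def init_configs_def)
  qed
qed

lemma sat_pred_axioms:
  assumes "\<phi> \<in> pred_axioms J" and "J \<subseteq> Q"
  shows "sat (quotient q0) v \<phi>"
proof -
  have app: "[quotient_fun Mult [h w, h [q]]] \<in> quotient_rel q0 (PS J)"
    if "w \<in> lists J" "q \<in> J" for w q
  proof -
    have "w \<in> lists Q" "q \<in> Q" "w @ [q] \<in> lists J" using that assms(2) by auto
    then show ?thesis by auto
  qed
  from assms(1) consider "\<phi> = PF J cE" | q where "q \<in> J" "\<phi> = Imp (PF J vx) (PF J (vx \<star> cQ q))"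
    by (auto simp: pred_axioms_def)
  then show ?thesis
  proof cases
    case 1
    then show ?thesis by (auto simp: quotient_def)
  next
    case 2
    then show ?thesis using app by (auto simp: quotient_def del: in_listsD in_listsI)
  qed
qed

section \<open>Failure of the bad patterns\<close>

text \<open>Replacing each variable by a representative of its value interleaves \<open>w\<close>
  with words over \<open>Q\<close>, so the term names the class of a superword. The induction runs
  over prefixes because the term is a left fold.\<close>

lemma tval_psi_term:
  assumes "w \<in> lists Q" and "range v \<subseteq> h ` lists Q" and "k \<le> length w"
  shows "\<exists>u\<in>lists Q. subseq (take k w) u \<and>
    tval (quotient q0) v (foldl (\<lambda>t i. (t \<star> cQ (w ! i)) \<star> Var (Suc i)) (Var 0) [0..<k]) = h u"
  using assms(3)
proof (induction k)
  case 0
  from assms(2) show ?case by (auto simp: image_subset_iff image_iff)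
next
  case (Suc k)
  then obtain u where u: "u \<in> lists Q" "subseq (take k w) u"
    "tval (quotient q0) v (foldl (\<lambda>t i. (t \<star> cQ (w ! i)) \<star> Var (Suc i)) (Var 0) [0..<k]) = h u"
    by auto
  from assms(2) obtain z where z: "z \<in> lists Q" "v (Suc k) = h z"
    by (auto simp: image_subset_iff image_iff)
  have wk: "w ! k \<in> Q" using assms(1) Suc.prems by auto
  have "subseq (take k w @ [w ! k] @ []) (u @ [w ! k] @ z)"
    using u by (intro list_emb_append_mono) auto
  then have "subseq (take (Suc k) w) (u @ [w ! k] @ z)"
    using Suc.prems by (simp add: take_Suc_conv_app_nth)
  then show ?case
    using u z wk by (intro bexI[of _ "u @ [w ! k] @ z"]) (auto simp: quotient_def)
qed

lemma not_sat_psi: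
  assumes "w \<in> lists Q" and "range v \<subseteq> h ` lists Q" and "\<And>u. u \<in> lists Q \<Longrightarrow> subseq w u \<Longrightarrow> u \<in> U"
  shows "\<not> sat (quotient q0) v (psi w)"
proof -
  from tval_psi_term[OF assms(1,2), of "length w" q0] obtain u where u: "u \<in> lists Q" "subseq w u"
    "tval (quotient q0) v (foldl (\<lambda>t i. (t \<star> cQ (w ! i)) \<star> Var (Suc i)) (Var 0) [0..<length w]) = h u"
    by auto
  then have "sat (quotient q0) v (psi w) \<longleftrightarrow> [h u] \<in> quotient_rel q0 RS"
    by (simp add: psi_def quotient_def del: quotient_rel.simps)
  with quotient_R_iff u assms(3) show ?thesis by blast
qed

section \<open>Assembling the finite model\<close>

lemma models_quotient:
  assumes P: "param_system Q T" and q0: "q0 \<in> Q" and F: "finite F" "F \<subseteq> lists Q"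
    and closed: "Pre Q T U \<subseteq> U" and bad: "bad_configs Q F \<subseteq> U" and init: "init_configs q0 \<inter> U = {}"
  shows "is_structure (vocab_funs Q) (vocab_rels T) (quotient q0)"
    and "models (quotient q0) (Phi T q0 \<union> {Neg (Psi F)})"
proof -
  have univ: "universe (quotient q0) = h ` lists Q" by (simp add: quotient_def)
  have over: "rule_over Q r" if "r \<in> T" for r using P that by (auto simp: param_system_def)
  have all: "J \<subseteq> Q" if "J \<in> all_sets T" for J
    using that over by (fastforce simp: all_sets_def)
  show "is_structure (vocab_funs Q) (vocab_rels T) (quotient q0)"
    using q0 all by (rule is_structure_quotient)
  have "sat (quotient q0) v \<phi>"
    if "\<phi> \<in> monoid_axioms \<union> init_axioms q0 \<union> (\<Union>J\<in>all_sets T. pred_axioms J) \<union> (\<Union>r\<in>T. rule_axioms r)"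
      and "range v \<subseteq> universe (quotient q0)" for v \<phi>
    using that(1)
  proof (elim UnE UN_E)
    assume "\<phi> \<in> monoid_axioms"
    then show ?thesis using that(2) unfolding univ by (rule sat_monoid_axioms)
  next
    assume "\<phi> \<in> init_axioms q0"
    then show ?thesis using q0 init by (rule sat_init_axioms)
  next
    fix J assume "J \<in> all_sets T" "\<phi> \<in> pred_axioms J"
    then show ?thesis using all sat_pred_axioms by blast
  next
    fix r assume "r \<in> T" "\<phi> \<in> rule_axioms r"
    then show ?thesis using closed over that(2) unfolding univ by (intro sat_rule_axioms)
  qed
  then have Phi: "sat (quotient q0) v \<phi>"
    if "\<phi> \<in> Phi T q0" "range v \<subseteq> universe (quotient q0)" for v \<phi>
    using that unfolding Phi_def all_closure_def by (elim imageE) (simp add: sat_foldr_Forall)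
  \<comment> \<open>Finiteness of \<open>F\<close> ensures that the chosen list really enumerates
    it.\<close>
  have "set (SOME ws. set ws = F) = F"
    using finite_list[OF F(1)] by (rule someI_ex)
  moreover have "\<not> sat (quotient q0) v (psi w)"
    if "w \<in> F" "range v \<subseteq> universe (quotient q0)" for v w
    using that F(2) bad unfolding univ by (intro not_sat_psi) (auto simp: bad_configs_def)
  ultimately have "\<not> sat (quotient q0) v (Psi F)" if "range v \<subseteq> universe (quotient q0)" for v
    unfolding Psi_def ex_closure_def using that
    by (intro not_sat_foldr_Exists) (auto simp: sat_foldr_Or)
  with Phi show "models (quotient q0) (Phi T q0 \<union> {Neg (Psi F)})"
    by (auto simp: models_def)
qed

end

theorem theorem1:
  fixes Q :: "'q set" and T :: "'q rule set" and q0 :: 'q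
    and F B U :: "'q list set" and n :: nat
  assumes "param_system Q T"
    and "q0 \<in> Q"
    and "finite F" and "F \<subseteq> lists Q"
    and "B = bad_configs Q F"
    and "U = backward_iter Q T B n"
    and "backward_iter Q T B (Suc n) = backward_iter Q T B n"
    and "init_configs q0 \<inter> U = {}"
  shows "\<exists>M :: ('q fsym, 'q rsym, nat) fo_structure.
           is_structure (vocab_funs Q) (vocab_rels T) M \<and> finite (universe M) \<and>
           models M (Phi T q0 \<union> {Neg (Psi F)})"
proof -
  \<comment> \<open>The longest word of \<open>F\<close> bounds the initial generators, and each of
    the \<open>n\<close> iterations adds at most two letters.\<close>
  define m where "m = Max (length ` F) + 2 * n"
  have U: "up_closed Q U" "generated_upto m U"
    using backward_iter_generated[of Q B "Max (length ` F)" T n] bad_configs_generated[of F Q] assms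
    by (auto simp: m_def)
  have closed: "Pre Q T U \<subseteq> U" using assms(6,7) by auto
  have "B \<subseteq> backward_iter Q T B i" for i by (induction i) auto
  then have bad: "bad_configs Q F \<subseteq> U" using assms(5,6) by blast
  have fin: "finite (short_subwords m ` lists Q)"
    using assms(1) by (intro finite_short_subwords_image) (simp add: param_system_def)
  \<comment> \<open>The finitely many classes are numbered, since the model must live on
    \<open>nat\<close>; injectivity keeps the kernel of \<open>h\<close> equal to the congruence on
    words over \<open>Q\<close>.\<close>
  then obtain code :: "'q list set \<Rightarrow> nat" where code: "inj_on code (short_subwords m ` lists Q)"
    using finite_imp_inj_to_nat_seg by blast
  define h where "h w = code (short_subwords m w)" for w
  have h: "short_subwords m u = short_subwords m v" if "h u = h v" "u \<in> lists Q" "v \<in> lists Q" for u v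
    using that code by (auto simp: h_def dest: inj_onD)
  interpret recognizing_quotient Q U h
  proof
    fix u u' v v' assume "u \<in> lists Q" "u' \<in> lists Q" "v \<in> lists Q" "v' \<in> lists Q"
      "h u = h u'" "h v = h v'"
    then have "short_subwords m u = short_subwords m u'" "short_subwords m v = short_subwords m v'"
      using h by blast+
    then have "short_subwords m (u @ v) = short_subwords m (u' @ v')"
      by (intro equalityI short_subwords_append_mono) auto
    then show "h (u @ v) = h (u' @ v')" by (simp add: h_def)
  next
    fix u v assume "u \<in> lists Q" "v \<in> lists Q" "h u = h v" "u \<in> U"
    then show "v \<in> U" using h short_subwords_saturated[OF U] by blast
  qed
  have "universe (quotient q0) = code ` short_subwords m ` lists Q"
    by (simp add: quotient_def h_def image_image)
  with fin have "finite (universe (quotient q0))" by simp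
  with models_quotient[OF assms(1-4) closed bad assms(8)] show ?thesis by blast
qed

end
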